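(* Let $\mathbb{T}=(\mathbb{Q}_p/\mathbb{Z}_p)^2$. For each choice, for every subgroup $H\subset\mathbb{T}$ of order $p$, of an endomorphism $\phi_H$ of $\mathbb{T}$ satisfying $$\phi_H^2=[p]=\begin{bmatrix}p&0\\0&p\end{bmatrix}\quad\text{and}\quad \phi_H(\mathbb{T}[p])=H,$$ there is a power section $\phi\in\Gamma(\mathrm{Sub}(\mathbb{T}),\mathrm{Isog}(\mathbb{T}))$, i.e. a section $\phi$ such that for all finite subgroups $K\subset H$ of $\mathbb{T}$ $$\phi_H=\phi_{H/K}\,\phi_K,\qquad\text{where } H/K=\phi_K(H).$$
   Context: $p$ is a prime. $\mathrm{Isog}(\mathbb{T})$ is the monoid of endomorphisms of $\mathbb{T}$ with finite kernel (elements are written as $2\times2$ matrices over $\mathbb{Z}_p$, acting on $(\mathbb{Q}_p/\mathbb{Z}_p)^2$), $\mathrm{Sub}(\mathbb{T})$ is the set of finite subgroups of $\mathbb{T}$, and $\mathrm{Isog}(\mathbb{T})\to\mathrm{Sub}(\mathbb{T})$ sends an isogeny to its kernel. $\Gamma(\mathrm{Sub}(\mathbb{T}),\mathrm{Isog}(\mathbb{T}))$ is the set of sections of this map: a section $\phi$ assigns to each finite subgroup $H$ an isogeny $\phi_H=\phi(H)$ with $\ker\phi_H=H$. $\mathbb{T}[p]$ is the $p$-torsion subgroup. *)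

theory Defs
  imports Complex_Main "HOL-Computational_Algebra.Primes" "HOL-Algebra.QuotRing"
begin

section \<open>The p-adic numbers and the group of their classes modulo the p-adic integers\<close>

definition padic_norm :: "nat \<Rightarrow> rat \<Rightarrow> real" where
  "padic_norm p x =
     (if x = 0 then 0
      else real p powi (int (multiplicity (int p) (snd (quotient_of x)))
                        - int (multiplicity (int p) (fst (quotient_of x)))))"

definition padic_Cauchy :: "nat \<Rightarrow> (nat \<Rightarrow> rat) \<Rightarrow> bool" where
  "padic_Cauchy p X \<longleftrightarrow> (\<forall>e>0. \<exists>N. \<forall>m\<ge>N. \<forall>n\<ge>N. padic_norm p (X m - X n) < e)"

definition padic_Cauchy_ring :: "nat \<Rightarrow> (nat \<Rightarrow> rat) ring" where
  "padic_Cauchy_ring p =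
     \<lparr>carrier = {X. padic_Cauchy p X},
      mult = (\<lambda>X Y n. X n * Y n), one = (\<lambda>n. 1),
      zero = (\<lambda>n. 0), add = (\<lambda>X Y n. X n + Y n)\<rparr>"

definition padic_null :: "nat \<Rightarrow> (nat \<Rightarrow> rat) set" where
  "padic_null p = {X. (\<lambda>n. padic_norm p (X n)) \<longlonglongrightarrow> 0}"

text \<open>The field of p-adic numbers, as the completion of the rationals for the p-adic norm.\<close>

definition Qp :: "nat \<Rightarrow> (nat \<Rightarrow> rat) set ring" where
  "Qp p = padic_Cauchy_ring p Quot padic_null p"

definition Qp_norm :: "nat \<Rightarrow> (nat \<Rightarrow> rat) set \<Rightarrow> real" where
  "Qp_norm p a = (THE r. \<forall>X\<in>a. (\<lambda>n. padic_norm p (X n)) \<longlonglongrightarrow> r)"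

definition Zp :: "nat \<Rightarrow> (nat \<Rightarrow> rat) set set" where
  "Zp p = {a \<in> carrier (Qp p). Qp_norm p a \<le> 1}"

text \<open>
  The groups below are written multiplicatively, as everywhere in the group library:
  the group law is addition of p-adic numbers modulo p-adic integers.
\<close>

definition Qp_mod_Zp :: "nat \<Rightarrow> (nat \<Rightarrow> rat) set set monoid" where
  "Qp_mod_Zp p = add_monoid (Qp p) Mod Zp p"

type_synonym torus_point = "(nat \<Rightarrow> rat) set set \<times> (nat \<Rightarrow> rat) set set"

definition TT :: "nat \<Rightarrow> torus_point monoid" where
  "TT p = Qp_mod_Zp p \<times>\<times> Qp_mod_Zp p"

text \<open>
  The diagonal matrix with both entries \<open>p\<close>, acting on pairs. As the group law is addition,
  the group power \<open>x [^] p\<close> is the multiple of \<open>x\<close> by the integer \<open>p\<close>.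
\<close>

definition mult_p :: "nat \<Rightarrow> torus_point \<Rightarrow> torus_point" where
  "mult_p p = (\<lambda>(x, y)\<in>carrier (TT p).
     (x [^]\<^bsub>Qp_mod_Zp p\<^esub> p, y [^]\<^bsub>Qp_mod_Zp p\<^esub> p))"

definition p_torsion :: "nat \<Rightarrow> torus_point set" where
  "p_torsion p = {x \<in> carrier (TT p). x [^]\<^bsub>TT p\<^esub> p = \<one>\<^bsub>TT p\<^esub>}"


section \<open>Endomorphisms, isogenies and power sections\<close>

text \<open>
  Endomorphisms are taken extensional, that is with a fixed dummy value outside the carrier, so
  that equality of functions is equality of endomorphisms; accordingly the product of
  endomorphisms is composition restricted to the carrier.
\<close>

definition End :: "('a, 'm) monoid_scheme \<Rightarrow> ('a \<Rightarrow> 'a) monoid" where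
  "End G = \<lparr>carrier = hom G G \<inter> extensional (carrier G),
            mult = compose (carrier G), one = (\<lambda>x\<in>carrier G. x)\<rparr>"

definition Isog :: "('a, 'm) monoid_scheme \<Rightarrow> ('a \<Rightarrow> 'a) monoid" where
  "Isog G = (End G)\<lparr>carrier := {f \<in> carrier (End G). finite (kernel G G f)}\<rparr>"

definition Sub :: "('a, 'm) monoid_scheme \<Rightarrow> 'a set set" where
  "Sub G = {H. subgroup H G \<and> finite H}"

definition sections :: "('a \<Rightarrow> 'b) \<Rightarrow> 'b set \<Rightarrow> 'a set \<Rightarrow> ('b \<Rightarrow> 'a) set" where
  "sections g B A = {s \<in> B \<rightarrow>\<^sub>E A. \<forall>b\<in>B. g (s b) = b}"

definition Isog_sections :: "('a, 'm) monoid_scheme \<Rightarrow> ('a set \<Rightarrow> 'a \<Rightarrow> 'a) set" where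
  "Isog_sections G = sections (kernel G G) (Sub G) (carrier (Isog G))"

definition power_section :: "('a, 'm) monoid_scheme \<Rightarrow> ('a set \<Rightarrow> 'a \<Rightarrow> 'a) \<Rightarrow> bool" where
  "power_section G \<phi> \<longleftrightarrow> \<phi> \<in> Isog_sections G \<and>
     (\<forall>H\<in>Sub G. \<forall>K\<in>Sub G. K \<subseteq> H \<longrightarrow> \<phi> H = \<phi> (\<phi> K ` H) \<otimes>\<^bsub>Isog G\<^esub> \<phi> K)"

end

theory Submission
  imports Defs "HOL-Algebra.Multiplicative_Group"
begin

text \<open>
  If \<open>K\<close> has order \<open>p\<close>, then \<open>\<psi> K\<close> kills \<open>K\<close> because its square \<open>[p]\<close> kills the \<open>p\<close>-torsion, and
  since the \<open>p\<close>-torsion has at most \<open>p\<^sup>2\<close> elements and \<open>\<psi> K\<close> maps it onto \<open>K\<close>, the kernel is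
  exactly \<open>K\<close>. So \<open>\<phi> H = \<phi> (\<psi> K ` H) \<circ> \<psi> K\<close>, for any \<open>K \<subseteq> H\<close> of order \<open>p\<close>, is a recursion on the
  order of \<open>H\<close>. The point is that its value does not depend on \<open>K\<close>. Of the torus only two
  facts matter: it is \<open>p\<close>-primary, and its \<open>p\<close>-torsion has at most \<open>p\<^sup>2\<close> elements.
\<close>

section \<open>Power sections from square roots of multiplication by a prime\<close>

text \<open>Finiteness stands beside the bound because \<open>card\<close> of an infinite set is 0,
  so the bound alone would say nothing.\<close>

locale prime_sqrt_system = comm_group G for G (structure) +
  fixes p :: nat and \<psi> :: "'a set \<Rightarrow> 'a \<Rightarrow> 'a"
  assumes prime: "Factorial_Ring.prime p"
    and finite_torsion: "finite {x \<in> carrier G. x [^] p = \<one>}"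
    and card_torsion: "card {x \<in> carrier G. x [^] p = \<one>} \<le> p\<^sup>2"
    and primary: "x \<in> carrier G \<Longrightarrow> \<exists>k::nat. x [^] (p ^ k) = \<one>"
    and psi_End: "\<lbrakk>subgroup H G; card H = p\<rbrakk> \<Longrightarrow> \<psi> H \<in> carrier (End G)"
    and psi_psi: "\<lbrakk>subgroup H G; card H = p; x \<in> carrier G\<rbrakk> \<Longrightarrow> \<psi> H (\<psi> H x) = x [^] p"
    and psi_torsion: "\<lbrakk>subgroup H G; card H = p\<rbrakk> \<Longrightarrow> \<psi> H ` {x \<in> carrier G. x [^] p = \<one>} = H"
begin

section \<open>Subgroups of order \<open>p\<close>\<close>

definition torsion :: "'a set" where
  "torsion = {x \<in> carrier G. x [^] p = \<one>}"

definition is_prime_order :: "'a set \<Rightarrow> bool" where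
  "is_prime_order K \<longleftrightarrow> subgroup K G \<and> card K = p"

lemma is_prime_orderD: "is_prime_order K \<Longrightarrow> subgroup K G" "is_prime_order K \<Longrightarrow> card K = p"
    "is_prime_order K \<Longrightarrow> finite K"
  using prime by (auto simp: is_prime_order_def intro!: card_ge_0_finite prime_gt_0_nat)

text \<open>By Lagrange, the order \<open>p\<close> of the subgroup kills each of its
  elements.\<close>

lemma is_prime_order_subset_torsion:
  assumes K: "is_prime_order K" shows "K \<subseteq> torsion"
proof
  fix x assume x: "x \<in> K"
  interpret K: subgroup K G by (rule is_prime_orderD(1)[OF K])
  have "x [^]\<^bsub>G\<lparr>carrier := K\<rparr>\<^esub> order (G\<lparr>carrier := K\<rparr>) = \<one>\<^bsub>G\<lparr>carrier := K\<rparr>\<^esub>"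
    by (rule group.pow_order_eq_1) (use x K.subgroup_is_group in \<open>auto simp: is_group\<close>)
  then show "x \<in> torsion"
    using x is_prime_orderD(2)[OF K] by (simp add: torsion_def order_def nat_pow_consistent[symmetric])
qed

lemma psi_group_hom: "is_prime_order K \<Longrightarrow> group_hom G G (\<psi> K)"
  using psi_End[of K] by (auto simp: is_prime_order_def End_def group_hom_def group_hom_axioms_def)

lemma psi_extensional: "is_prime_order K \<Longrightarrow> \<psi> K \<in> extensional (carrier G)"
  using psi_End[of K] by (auto simp: is_prime_order_def End_def)

text \<open>Multiplying kernel elements by chosen torsion preimages of elements of \<open>K\<close>
  is injective into the torsion. Hence the kernel has at most \<open>p\<close> elements, and it
  contains \<open>K\<close>.\<close>

lemma kernel_psi:
  assumes K: "is_prime_order K"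
  shows "kernel G G (\<psi> K) = K"
proof -
  interpret f: group_hom G G "\<psi> K" by (rule psi_group_hom[OF K])
  interpret K: subgroup K G by (rule is_prime_orderD(1)[OF K])
  have sq: "\<psi> K (\<psi> K x) = x [^] p" if "x \<in> carrier G" for x
    using psi_psi K that by (auto simp: is_prime_order_def)
  have img: "\<psi> K ` torsion = K"
    using psi_torsion K by (auto simp: is_prime_order_def torsion_def)
  have fin: "finite torsion" and card_le: "card torsion \<le> p * p"
    using finite_torsion card_torsion by (simp_all add: torsion_def power2_eq_square)
  have ker_sub: "kernel G G (\<psi> K) \<subseteq> torsion"
  proof
    fix x assume "x \<in> kernel G G (\<psi> K)"
    then have "x \<in> carrier G" "\<psi> K x = \<one>" by (simp_all add: kernel_def)
    then show "x \<in> torsion" using sq[of x] by (auto simp: torsion_def)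
  qed
  \<comment> \<open>An element of \<open>K\<close> is \<open>\<psi> K t\<close> with
    \<open>t\<close> in the torsion, so \<open>\<psi> K\<close> sends it to \<open>t [^] p\<close>,
    which is trivial.\<close>
  have sub_ker: "K \<subseteq> kernel G G (\<psi> K)"
  proof
    fix h assume h: "h \<in> K"
    then obtain t where t: "t \<in> torsion" "h = \<psi> K t" using img by blast
    then show "h \<in> kernel G G (\<psi> K)" using sq[of t] h by (auto simp: kernel_def torsion_def)
  qed
  have ker_carr: "k \<in> carrier G" if "k \<in> kernel G G (\<psi> K)" for k
    using that by (simp add: kernel_def)
  define t where "t = inv_into torsion (\<psi> K)"
  have t: "t h \<in> torsion" "\<psi> K (t h) = h" if "h \<in> K" for h
    using that img by (auto simp: t_def inv_into_into f_inv_into_f)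
  have t_carr: "t h \<in> carrier G" if "h \<in> K" for h using t(1)[OF that] by (simp add: torsion_def)
  have val: "\<psi> K (k \<otimes> t h) = h" if "k \<in> kernel G G (\<psi> K)" "h \<in> K" for k h
    using that t t_carr by (auto simp: kernel_def)
  have "inj_on (\<lambda>(k, h). k \<otimes> t h) (kernel G G (\<psi> K) \<times> K)"
  proof (rule inj_onI; clarsimp)
    fix k h k' h'
    assume *: "k \<in> kernel G G (\<psi> K)" "h \<in> K" "k' \<in> kernel G G (\<psi> K)" "h' \<in> K"
      and eq: "k \<otimes> t h = k' \<otimes> t h'"
    \<comment> \<open>Applying \<open>\<psi> K\<close> kills \<open>k\<close> and \<open>k'\<close>
      and recovers \<open>h\<close> and \<open>h'\<close>.\<close>
    have "h = h'" using val[of k h] val[of k' h'] * eq by simp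
    then show "k = k' \<and> h = h'" using * eq t_carr[of h'] ker_carr by simp
  qed
  moreover have "(\<lambda>(k, h). k \<otimes> t h) ` (kernel G G (\<psi> K) \<times> K) \<subseteq> torsion"
    using t t_carr ker_sub by (auto simp: torsion_def nat_pow_distrib)
  ultimately have "card (kernel G G (\<psi> K) \<times> K) \<le> card torsion"
    using fin by (rule card_inj_on_le)
  also note card_le
  finally have "card (kernel G G (\<psi> K)) * p \<le> p * p"
    using is_prime_orderD(2)[OF K] by (simp add: card_cartesian_product)
  then have "card (kernel G G (\<psi> K)) \<le> card K"
    using prime_gt_0_nat[OF prime] is_prime_orderD(2)[OF K] by simp
  then show ?thesis
    using card_seteq[OF finite_subset[OF ker_sub fin] sub_ker] by simp
qed

lemma psi_image_subgroup: "\<lbrakk>is_prime_order K; subgroup H G\<rbrakk> \<Longrightarrow> subgroup (\<psi> K ` H) G"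
  by (rule group_hom.subgroup_img_is_subgroup[OF psi_group_hom])

text \<open>The nontrivial subgroup \<open>K\<close> of \<open>H\<close> is killed, so
  \<open>\<psi> K\<close> is not injective on \<open>H\<close>. This strict drop drives every
  induction below.\<close>

lemma card_psi_image_less:
  assumes K: "is_prime_order K" and H: "finite H" "K \<subseteq> H"
  shows "card (\<psi> K ` H) < card H"
proof -
  interpret K: subgroup K G by (rule is_prime_orderD(1)[OF K])
  have "1 < card K" using prime_gt_1_nat[OF prime] is_prime_orderD(2)[OF K] by simp
  then have "K \<noteq> {\<one>}" by auto
  then obtain x where x: "x \<in> K" "x \<noteq> \<one>" using K.one_closed by blast
  have "\<psi> K x = \<one>" "\<psi> K \<one> = \<one>"
    using x kernel_psi[OF K] K.one_closed unfolding kernel_def by blast+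
  then have "\<not> inj_on (\<psi> K) H"
    using x H K.one_closed by (metis inj_onD subsetD)
  then show ?thesis
    using H card_image_le[of H "\<psi> K"] eq_card_imp_inj_on[of H "\<psi> K"] by fastforce
qed

text \<open>If \<open>p ^ k\<close> is the least power of \<open>p\<close> killing some
  \<open>x \<noteq> \<one>\<close> in \<open>H\<close>, then \<open>x [^] (p ^ (k - 1))\<close> has
  order \<open>p\<close> and generates the subgroup sought.\<close>

lemma ex_is_prime_order_subset:
  assumes H: "subgroup H G" "H \<noteq> {\<one>}"
  shows "\<exists>K. is_prime_order K \<and> K \<subseteq> H"
proof -
  interpret H: subgroup H G by (rule H)
  obtain x where x: "x \<in> H" "x \<noteq> \<one>" using H H.one_closed by blast
  define k where "k = (LEAST k. x [^] (p ^ k) = \<one>)"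
  have k: "x [^] (p ^ k) = \<one>"
    unfolding k_def by (rule LeastI_ex) (use primary x in auto)
  have "k \<noteq> 0"
  proof
    assume "k = 0"
    then show False using k x by simp
  qed
  then obtain m where m: "k = Suc m" by (cases k) auto
  define y where "y = x [^] (p ^ m)"
  have y1: "y \<noteq> \<one>"
    unfolding y_def using not_less_Least[of m "\<lambda>k. x [^] (p ^ k) = \<one>"] m by (auto simp: k_def)
  have yH: "y \<in> H" using x by (simp add: y_def nat_pow_consistent[of _ _ H]
        monoid.nat_pow_closed[OF group.is_monoid[OF H.subgroup_is_group[OF is_group]], simplified])
  have yp: "y [^] p = \<one>" using k x by (simp add: y_def nat_pow_pow m mult.commute)
  have yG: "y \<in> carrier G" using yH by simp
  have "ord y dvd p" using yp yG by (simp add: pow_eq_id)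
  moreover have "ord y \<noteq> 1" using y1 yG ord_eq_1 by auto
  ultimately have "ord y = p" using prime prime_nat_iff by blast
  then have "card (generate G {y}) = p" using generate_pow_card[OF yG] by simp
  then have "is_prime_order (generate G {y})"
    using yG by (simp add: is_prime_order_def generate_is_subgroup)
  moreover have "generate G {y} \<subseteq> H" using yH H(1) by (simp add: generate_subgroup_incl)
  ultimately show ?thesis by blast
qed

text \<open>Distinct subgroups of order \<open>p\<close> meet trivially, so their product has
  \<open>p * p\<close> elements. It lies in the torsion, which is no larger, hence equals
  it.\<close>

lemma torsion_subset:
  assumes K: "is_prime_order K" "is_prime_order L" "K \<noteq> L" and H: "subgroup H G" "K \<subseteq> H" "L \<subseteq> H"
  shows "torsion \<subseteq> H"
proof -
  interpret K: subgroup K G by (rule is_prime_orderD(1)[OF K(1)])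
  interpret L: subgroup L G by (rule is_prime_orderD(1)[OF K(2)])
  interpret H: subgroup H G by (rule H)
  have cards: "card K = p" "card L = p" "finite K" "finite L"
    using K is_prime_orderD by auto
  have KL: "subgroup (K \<inter> L) G"
    by (rule subgroups_Inter_pair) (use K is_prime_orderD in auto)
  have "subgroup (K \<inter> L) (G\<lparr>carrier := K\<rparr>)"
    by (rule subgroup_incl) (use KL K is_prime_orderD in auto)
  then have "card (rcosets\<^bsub>G\<lparr>carrier := K\<rparr>\<^esub> (K \<inter> L)) * card (K \<inter> L) = p"
    using group.lagrange[OF K.subgroup_is_group[OF is_group]] cards(1) by (simp add: order_def)
  then have "card (K \<inter> L) dvd p" by (metis dvd_triv_right)
  moreover have "card (K \<inter> L) \<noteq> p"
  proof
    assume "card (K \<inter> L) = p"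
    then have "K \<inter> L = K" "K \<inter> L = L" using cards by (simp_all add: card_subset_eq)
    then show False using K by auto
  qed
  ultimately have "card (K \<inter> L) = 1" using prime prime_nat_iff by blast
  then obtain z where "K \<inter> L = {z}" by (auto simp: card_1_singleton_iff)
  moreover have "\<one> \<in> K \<inter> L" by simp
  ultimately have triv: "K \<inter> L = {\<one>}" by simp
  have "inj_on (\<lambda>(k, l). k \<otimes> l) (K \<times> L)"
  proof (rule inj_onI; clarsimp)
    fix k l k' l'
    assume *: "k \<in> K" "l \<in> L" "k' \<in> K" "l' \<in> L" and eq: "k \<otimes> l = k' \<otimes> l'"
    \<comment> \<open>The element \<open>inv k' \<otimes> k = l' \<otimes> inv l\<close> lies in
      both \<open>K\<close> and \<open>L\<close>, so it is trivial.\<close>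
    have "inv k' \<otimes> k = inv k' \<otimes> (k \<otimes> l) \<otimes> inv l" using * by (simp add: m_assoc)
    also have "\<dots> = l' \<otimes> inv l" using * by (simp add: eq m_assoc[symmetric])
    also have "\<dots> \<in> L" using * by simp
    finally have "inv k' \<otimes> k \<in> L" .
    moreover have "inv k' \<otimes> k \<in> K" using * by simp
    ultimately have "inv k' \<otimes> k = \<one>" using triv by auto
    then have "k' \<otimes> (inv k' \<otimes> k) = k'" using * by simp
    then have "k = k'" using * by (simp add: m_assoc[symmetric])
    then show "k = k' \<and> l = l'" using * eq by simp
  qed
  then have card: "card ((\<lambda>(k, l). k \<otimes> l) ` (K \<times> L)) = p\<^sup>2"
    using cards by (simp add: card_image card_cartesian_product power2_eq_square)
  have tors: "K \<subseteq> torsion" "L \<subseteq> torsion"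
    using K is_prime_order_subset_torsion by auto
  have "k \<otimes> l \<in> torsion" if "k \<in> K" "l \<in> L" for k l
  proof -
    have "k \<in> torsion" "l \<in> torsion" using that tors by blast+
    then show ?thesis by (simp add: torsion_def nat_pow_distrib)
  qed
  then have sub: "(\<lambda>(k, l). k \<otimes> l) ` (K \<times> L) \<subseteq> torsion"
    by (simp add: image_subset_iff)
  have "(\<lambda>(k, l). k \<otimes> l) ` (K \<times> L) = torsion"
    by (rule card_seteq[OF finite_torsion[folded torsion_def] sub])
       (simp add: card card_torsion[folded torsion_def])
  moreover have "(\<lambda>(k, l). k \<otimes> l) ` (K \<times> L) \<subseteq> H"
    using H(2,3) by (force simp: image_subset_iff)
  ultimately show ?thesis by simp
qed

section \<open>The recursion and its independence of choices\<close>

text \<open>The size test makes termination evident for arbitrary sets. It succeeds for nontrivial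
  finite subgroups, and the default is the identity, which is the right value at the trivial
  subgroup.\<close>

function \<phi> :: "'a set \<Rightarrow> 'a \<Rightarrow> 'a" where
  "\<phi> H = (let K = (SOME K. is_prime_order K \<and> K \<subseteq> H) in
     if card (\<psi> K ` H) < card H then compose (carrier G) (\<phi> (\<psi> K ` H)) (\<psi> K)
     else (\<lambda>x\<in>carrier G. x))"
  by auto
termination by (relation "measure card") auto

declare \<phi>.simps [simp del]

text \<open>No subgroup of order \<open>p\<close> is available here, so the chosen \<open>K\<close>
  is unspecified. Still, any map sends a singleton to a singleton, and the size test fails.\<close>

lemma phi_triv: "\<phi> {\<one>} = (\<lambda>x\<in>carrier G. x)"
  by (subst \<phi>.simps) (simp add: Let_def)

lemma phi_step_ex:
  assumes H: "subgroup H G" "finite H" "H \<noteq> {\<one>}"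
  shows "\<exists>K. is_prime_order K \<and> K \<subseteq> H \<and> \<phi> H = compose (carrier G) (\<phi> (\<psi> K ` H)) (\<psi> K)"
proof -
  define K where "K = (SOME K. is_prime_order K \<and> K \<subseteq> H)"
  have K: "is_prime_order K \<and> K \<subseteq> H"
    unfolding K_def by (rule someI_ex[OF ex_is_prime_order_subset]) (use H in auto)
  then have "\<phi> H = compose (carrier G) (\<phi> (\<psi> K ` H)) (\<psi> K)"
    using card_psi_image_less[of K H] H by (subst \<phi>.simps) (simp add: K_def[symmetric] Let_def)
  then show ?thesis using K by blast
qed

lemma phi_extensional: "\<phi> H \<in> extensional (carrier G)"
  by (subst \<phi>.simps) (auto simp: Let_def)

text \<open>The restricted map \<open>compose (carrier G) f g\<close> is evaluated at values of
  \<open>h\<close>, which therefore must stay in the carrier.\<close>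

lemma compose_compose:
  "h \<in> carrier G \<rightarrow> carrier G \<Longrightarrow> compose (carrier G) (compose (carrier G) f g) h
     = compose (carrier G) f (compose (carrier G) g h)"
  by (auto simp: compose_def fun_eq_iff Pi_iff)

text \<open>
  If \<open>H\<close> contains two subgroups of order \<open>p\<close>, it contains the whole \<open>p\<close>-torsion, so
  \<open>K = \<psi> K ` torsion \<subseteq> \<psi> K ` H\<close> and a second step along \<open>K\<close> turns the composite into
  \<open>\<phi> (p H) \<circ> [p]\<close>, which does not depend on \<open>K\<close>.
\<close>

lemma phi_step:
  assumes "subgroup H G" "finite H" "is_prime_order K" "K \<subseteq> H"
  shows "\<phi> H = compose (carrier G) (\<phi> (\<psi> K ` H)) (\<psi> K)"
  using assms
proof (induction "card H" arbitrary: H K rule: less_induct)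
  case less
  have "1 < card K" using prime_gt_1_nat[OF prime] is_prime_orderD(2)[OF less.prems(3)] by simp
  then have "H \<noteq> {\<one>}"
    using less.prems card_mono[of H K] by auto
  then obtain L where L: "is_prime_order L" "L \<subseteq> H"
      and phi: "\<phi> H = compose (carrier G) (\<phi> (\<psi> L ` H)) (\<psi> L)"
    using phi_step_ex less.prems by blast
  show ?case
  proof (cases "K = L")
    case True
    then show ?thesis using phi by simp
  next
    case False
    have tors: "torsion \<subseteq> H"
      using torsion_subset[OF less.prems(3) L(1) False less.prems(1,4) L(2)] .
    have key: "compose (carrier G) (\<phi> (\<psi> M ` H)) (\<psi> M)
        = compose (carrier G) (\<phi> ((\<lambda>x. x [^] p) ` H)) (\<lambda>x\<in>carrier G. x [^] p)"
      if M: "is_prime_order M" "M \<subseteq> H" for M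
    proof -
      interpret f: group_hom G G "\<psi> M" by (rule psi_group_hom[OF M(1)])
      have sq: "\<psi> M (\<psi> M x) = x [^] p" if "x \<in> carrier G" for x
        using psi_psi M that by (auto simp: is_prime_order_def)
      have "M \<subseteq> \<psi> M ` H"
        using tors psi_torsion[of M] M(1) unfolding is_prime_order_def torsion_def by blast
      \<comment> \<open>The image of \<open>H\<close> is smaller, so by induction the second step
        may go along \<open>M\<close> itself instead of the subgroup picked by the
        recursion.\<close>
      then have "\<phi> (\<psi> M ` H) = compose (carrier G) (\<phi> (\<psi> M ` \<psi> M ` H)) (\<psi> M)"
        using less.prems M card_psi_image_less[of M H] by (intro less.hyps psi_image_subgroup) auto
      moreover have "\<psi> M ` \<psi> M ` H = (\<lambda>x. x [^] p) ` H"
        using sq subgroup.subset[OF less.prems(1)] by (force simp: image_image intro!: image_cong)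
      ultimately show ?thesis
        using sq by (auto simp: compose_def fun_eq_iff)
    qed
    show ?thesis using phi key[OF L] key[OF less.prems(3,4)] by simp
  qed
qed

section \<open>Kernels and the power law\<close>

text \<open>By induction the kernel is the preimage under \<open>\<psi> K\<close> of the image of
  \<open>H\<close>. This is \<open>H\<close>, because \<open>H\<close> contains the kernel
  \<open>K\<close> of \<open>\<psi> K\<close>.\<close>

lemma phi_hom_kernel:
  assumes "subgroup H G" "finite H"
  shows "\<phi> H \<in> hom G G \<and> kernel G G (\<phi> H) = H"
  using assms
proof (induction "card H" arbitrary: H rule: less_induct)
  case less
  show ?case
  proof (cases "H = {\<one>}")
    case True
    then show ?thesis by (auto simp: phi_triv hom_def kernel_def)
  next
    case False
    then obtain K where K: "is_prime_order K" "K \<subseteq> H" using ex_is_prime_order_subset less.prems by blast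
    interpret H: subgroup H G by (rule less.prems)
    interpret f: group_hom G G "\<psi> K" by (rule psi_group_hom[OF K(1)])
    have phi: "\<phi> H = compose (carrier G) (\<phi> (\<psi> K ` H)) (\<psi> K)"
      by (rule phi_step) (use less.prems K in auto)
    have IH: "\<phi> (\<psi> K ` H) \<in> hom G G" "kernel G G (\<phi> (\<psi> K ` H)) = \<psi> K ` H"
      using less.hyps[of "\<psi> K ` H"] card_psi_image_less[of K H] less.prems K psi_image_subgroup
      by auto
    have hom: "\<phi> H \<in> hom G G"
      unfolding phi using IH(1) f.homh by (auto simp: hom_def compose_def Pi_iff)
    have "x \<in> kernel G G (\<phi> H) \<longleftrightarrow> x \<in> H" if x: "x \<in> carrier G" for x
    proof -
      have "x \<in> kernel G G (\<phi> H) \<longleftrightarrow> \<psi> K x \<in> kernel G G (\<phi> (\<psi> K ` H))"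
        using x by (simp add: phi kernel_def compose_def)
      also have "\<dots> \<longleftrightarrow> \<psi> K x \<in> \<psi> K ` H" by (simp add: IH)
      also have "\<dots> \<longleftrightarrow> x \<in> H"
      proof
        assume "\<psi> K x \<in> \<psi> K ` H"
        then obtain h where h: "h \<in> H" "\<psi> K x = \<psi> K h" by blast
        then have "x \<otimes> inv h \<in> kernel G G (\<psi> K)" using x by (simp add: kernel_def)
        then have "x \<otimes> inv h \<in> H" using kernel_psi[OF K(1)] K(2) by auto
        then have "x \<otimes> inv h \<otimes> h \<in> H" using h by blast
        then show "x \<in> H" using x h by (simp add: m_assoc)
      qed auto
      finally show ?thesis .
    qed
    then have "kernel G G (\<phi> H) = H" by (auto simp: kernel_def)
    then show ?thesis using hom by blast
  qed
qed

text \<open>Stepping along \<open>K\<close> itself leaves the trivial subgroup, where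
  \<open>\<phi>\<close> is the identity. Extensionality of \<open>\<psi> K\<close> makes this an
  equality of functions.\<close>

lemma phi_min:
  assumes K: "is_prime_order K" shows "\<phi> K = \<psi> K"
proof -
  interpret f: group_hom G G "\<psi> K" by (rule psi_group_hom[OF K])
  have "\<psi> K k = \<one>" if "k \<in> K" for k
    using that kernel_psi[OF K] unfolding kernel_def by blast
  then have img: "\<psi> K ` K = {\<one>}"
    using subgroup.one_closed[OF is_prime_orderD(1)[OF K]] by (force simp: image_iff)
  have "\<phi> K = compose (carrier G) (\<phi> (\<psi> K ` K)) (\<psi> K)"
    by (rule phi_step) (use is_prime_orderD[OF K] K in auto)
  also have "\<dots> = \<psi> K"
    using img psi_extensional[OF K]
    by (auto simp: phi_triv compose_def fun_eq_iff extensional_def)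
  finally show ?thesis .
qed

text \<open>Induction on the order of \<open>K\<close>: a subgroup \<open>L\<close> of order
  \<open>p\<close> in \<open>K\<close> is split off from both \<open>\<phi> H\<close> and
  \<open>\<phi> K\<close>, and the induction hypothesis applies to the images of \<open>K\<close>
  and \<open>H\<close> under \<open>\<psi> L\<close>.\<close>

lemma phi_compose:
  assumes "subgroup H G" "finite H" "subgroup K G" "K \<subseteq> H"
  shows "\<phi> H = compose (carrier G) (\<phi> (\<phi> K ` H)) (\<phi> K)"
  using assms
proof (induction "card K" arbitrary: K H rule: less_induct)
  case less
  have finK: "finite K" using less.prems finite_subset by blast
  show ?case
  proof (cases "K = {\<one>}")
    case True
    have "(\<lambda>x\<in>carrier G. x) ` H = H" using subgroup.subset[OF less.prems(1)] by force
    then show ?thesis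
      using phi_extensional[of H] True
      by (auto simp: phi_triv compose_def fun_eq_iff extensional_def)
  next
    case False
    then obtain L where L: "is_prime_order L" "L \<subseteq> K" using ex_is_prime_order_subset less.prems by blast
    interpret f: group_hom G G "\<psi> L" by (rule psi_group_hom[OF L(1)])
    have K: "\<phi> K = compose (carrier G) (\<phi> (\<psi> L ` K)) (\<psi> L)"
      by (rule phi_step) (use less.prems finK L in auto)
    \<comment> \<open>The quotient of \<open>H\<close> by \<open>K\<close> is formed in two stages,
      first by \<open>L\<close>, then by the image of \<open>K\<close>.\<close>
    have "\<phi> K ` H = \<phi> (\<psi> L ` K) ` \<psi> L ` H"
      using subgroup.subset[OF less.prems(1)] unfolding image_image
      by (intro image_cong) (auto simp: K compose_def)
    moreover have "\<phi> (\<psi> L ` H) = compose (carrier G)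
        (\<phi> (\<phi> (\<psi> L ` K) ` \<psi> L ` H)) (\<phi> (\<psi> L ` K))"
      using less.prems finK L card_psi_image_less[of L K]
      by (intro less.hyps psi_image_subgroup) auto
    moreover have "\<phi> H = compose (carrier G) (\<phi> (\<psi> L ` H)) (\<psi> L)"
      by (rule phi_step) (use less.prems L in auto)
    ultimately show ?thesis
      using f.homh by (simp add: K compose_compose hom_def)
  qed
qed

theorem ex_power_section:
  "\<exists>\<phi>. power_section G \<phi> \<and> (\<forall>H. subgroup H G \<longrightarrow> card H = p \<longrightarrow> \<phi> H = \<psi> H)"
proof (intro exI conjI allI impI)
  \<comment> \<open>Sections are extensional on \<open>Sub G\<close>, hence the restriction.\<close>
  let ?\<phi> = "\<lambda>H\<in>Sub G. \<phi> H"
  show "?\<phi> H = \<psi> H" if "subgroup H G" "card H = p" for H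
    using that is_prime_orderD(3)[of H] phi_min[of H] by (auto simp: Sub_def is_prime_order_def)
  have img: "\<phi> K ` H \<in> Sub G" if "H \<in> Sub G" "K \<in> Sub G" for H K
    using that phi_hom_kernel[of K] group_hom.subgroup_img_is_subgroup[of G G "\<phi> K" H]
    by (auto simp: Sub_def group_hom_def group_hom_axioms_def is_group)
  have "?\<phi> \<in> Isog_sections G"
    using phi_hom_kernel phi_extensional
    by (auto simp: Isog_sections_def sections_def Isog_def End_def Sub_def)
  moreover have "?\<phi> H = ?\<phi> (?\<phi> K ` H) \<otimes>\<^bsub>Isog G\<^esub> ?\<phi> K"
    if "H \<in> Sub G" "K \<in> Sub G" "K \<subseteq> H" for H K
    using that img[OF that(1,2)] phi_compose[of H K] by (simp add: Isog_def End_def Sub_def)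
  ultimately show "power_section G ?\<phi>"
    unfolding power_section_def by blast
qed

end

section \<open>The p-adic norm\<close>

context
  fixes p :: nat
  assumes prime: "Factorial_Ring.prime p"
begin

lemma p_gt_1: "1 < real p"
  using prime_gt_1_nat[OF prime] by simp

lemma prime_elem_int: "prime_elem (int p)"
  using prime by simp

text \<open>Cross-multiplying with the reduced fraction shows that the difference of multiplicities
  is the same for every representation.\<close>

lemma padic_norm_frac:
  assumes "a \<noteq> 0" "b \<noteq> 0"
  shows "padic_norm p (of_int a / of_int b)
    = real p powi (int (multiplicity (int p) b) - int (multiplicity (int p) a))"
proof -
  obtain c d where q: "quotient_of (of_int a / of_int b) = (c, d)" by force
  have d: "d > 0" using quotient_of_denom_pos[OF q] .
  have eq: "(of_int a / of_int b :: rat) = of_int c / of_int d"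
    by (rule quotient_of_div[OF q])
  with assms d have "of_int (a * d) = (of_int (c * b) :: rat)" by (simp add: field_simps)
  then have ad: "a * d = c * b" by (simp only: of_int_eq_iff)
  then have c: "c \<noteq> 0" using assms d by auto
  have "multiplicity (int p) a + multiplicity (int p) d
      = multiplicity (int p) c + multiplicity (int p) b"
    using ad assms c d prime_elem_multiplicity_mult_distrib[OF prime_elem_int]
    by (metis less_irrefl)
  then have "int (multiplicity (int p) d) - int (multiplicity (int p) c)
      = int (multiplicity (int p) b) - int (multiplicity (int p) a)" by linarith
  then show ?thesis
    using assms by (simp add: padic_norm_def q)
qed

lemma rat_cases:
  obtains "x = 0" | a b where "a \<noteq> 0" "b \<noteq> 0" "x = (of_int a / of_int b :: rat)"
proof -
  obtain c d where q: "quotient_of x = (c, d)" by force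
  have x: "x = of_int c / of_int d" and d: "d \<noteq> 0"
    using quotient_of_div[OF q] quotient_of_denom_pos[OF q] by simp_all
  show thesis
  proof (cases "c = 0")
    case True
    then show thesis using that(1) x by simp
  next
    case False
    then show thesis using that(2) x d by blast
  qed
qed

lemma padic_norm_0 [simp]: "padic_norm p 0 = 0"
  by (simp add: padic_norm_def)

lemma padic_norm_nonneg [simp]: "0 \<le> padic_norm p x"
  by (simp add: padic_norm_def)

lemma padic_norm_mult: "padic_norm p (x * y) = padic_norm p x * padic_norm p y"
proof (cases x rule: rat_cases)
  case (2 a b)
  note x = 2
  show ?thesis
  proof (cases y rule: rat_cases)
    case (2 c d)
    have xy: "x * y = of_int (a * c) / of_int (b * d)" by (simp add: x 2)
    have "padic_norm p (x * y) = real p powi (int (multiplicity (int p) (b * d))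
        - int (multiplicity (int p) (a * c)))"
      unfolding xy by (rule padic_norm_frac) (use x 2 in auto)
    then show ?thesis
      using x 2 p_gt_1
      by (simp add: padic_norm_frac prime_elem_multiplicity_mult_distrib[OF prime_elem_int]
          flip: power_int_add) (simp add: algebra_simps)
  qed simp
qed simp

lemma padic_norm_self: "padic_norm p (of_nat p) = 1 / real p"
  using padic_norm_frac[of "int p" 1] prime p_gt_1 by (simp add: power_int_minus field_simps)

lemma padic_norm_of_nat_power: "padic_norm p (of_nat p ^ k) = 1 / real p ^ k"
proof (induction k)
  case 0
  show ?case using padic_norm_frac[of 1 1] by simp
next
  case (Suc k)
  then show ?case by (simp add: padic_norm_mult padic_norm_self)
qed

lemma padic_norm_minus: "padic_norm p (- x) = padic_norm p x"
proof -
  have "padic_norm p (- 1) = 1"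
    using padic_norm_frac[of "- 1" 1] multiplicity_unit_right[of "- 1 :: int"] by simp
  then show ?thesis using padic_norm_mult[of "- 1" x] by simp
qed

lemma padic_norm_diff_commute: "padic_norm p (x - y) = padic_norm p (y - x)"
  using padic_norm_minus[of "x - y"] by simp

text \<open>Over a common denominator \<open>m\<close>, the smaller of the two powers of
  \<open>p\<close> in the numerators divides their sum.\<close>

lemma padic_norm_add_max: "padic_norm p (x + y) \<le> max (padic_norm p x) (padic_norm p y)"
proof (cases x rule: rat_cases)
  case (2 a b)
  note x = 2
  show ?thesis
  proof (cases y rule: rat_cases)
    case (2 c d)
    define s t m where "s = a * d" and "t = c * b" and "m = b * d"
    have nz: "s \<noteq> 0" "t \<noteq> 0" "m \<noteq> 0" using x 2 by (simp_all add: s_def t_def m_def)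
    have eqs: "x = of_int s / of_int m" "y = of_int t / of_int m"
      using x 2 by (simp_all add: s_def t_def m_def)
    then have sum: "x + y = of_int (s + t) / of_int m" by (simp add: add_divide_distrib)
    show ?thesis
    proof (cases "s + t = 0")
      case True
      then show ?thesis by (simp add: sum le_max_iff_disj)
    next
      case False
      define k where "k = min (multiplicity (int p) s) (multiplicity (int p) t)"
      have "int p ^ k dvd s + t"
        by (intro dvd_add multiplicity_dvd') (simp_all add: k_def)
      then have "k \<le> multiplicity (int p) (s + t)"
        using False prime_elem_int by (intro multiplicity_geI) auto
      moreover have "padic_norm p (x + y)
          = real p powi (int (multiplicity (int p) m) - int (multiplicity (int p) (s + t)))"
        unfolding sum using False nz(3) by (rule padic_norm_frac)
      ultimately have "padic_norm p (x + y) \<le> real p powi (int (multiplicity (int p) m) - int k)"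
        using p_gt_1 by (simp add: power_int_increasing)
      also have "\<dots> \<le> max (padic_norm p x) (padic_norm p y)"
        using nz by (simp add: eqs padic_norm_frac k_def min_def)
      finally show ?thesis .
    qed
  qed simp
qed simp

lemma padic_norm_add: "padic_norm p (x + y) \<le> padic_norm p x + padic_norm p y"
  using padic_norm_add_max[of x y] padic_norm_nonneg[of x] padic_norm_nonneg[of y] by linarith

lemma padic_norm_abs_diff: "\<bar>padic_norm p x - padic_norm p y\<bar> \<le> padic_norm p (x - y)"
  using padic_norm_add[of "x - y" y] padic_norm_add[of "y - x" x] padic_norm_diff_commute[of x y]
  by simp

text \<open>Nonzero norms are integer powers of \<open>p\<close>, so none lies strictly between
  consecutive powers.\<close>

lemma padic_norm_discrete:
  assumes "padic_norm p x < real p powi k"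
  shows "padic_norm p x \<le> real p powi (k - 1)"
proof (cases "x = 0")
  case False
  then obtain i where i: "padic_norm p x = real p powi i" by (auto simp: padic_norm_def)
  have "i < k"
  proof (rule ccontr)
    assume "\<not> i < k"
    then have "real p powi k \<le> real p powi i" using p_gt_1 by (intro power_int_increasing) auto
    then show False using assms i by simp
  qed
  then show ?thesis using i p_gt_1 by (simp add: power_int_increasing)
qed (use p_gt_1 in simp)

section \<open>Cauchy sequences and the quotients defining the torus\<close>

definition Cauchy_group :: "(nat \<Rightarrow> rat) monoid" where
  "Cauchy_group = add_monoid (padic_Cauchy_ring p)"

lemma Cauchy_group_simps:
  "X \<in> carrier Cauchy_group \<longleftrightarrow> padic_Cauchy p X"
  "X \<otimes>\<^bsub>Cauchy_group\<^esub> Y = (\<lambda>n. X n + Y n)"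
  "\<one>\<^bsub>Cauchy_group\<^esub> = (\<lambda>n. 0)"
  by (simp_all add: Cauchy_group_def padic_Cauchy_ring_def)

lemma padic_Cauchy_const: "padic_Cauchy p (\<lambda>n. c)"
  by (auto simp: padic_Cauchy_def)

lemma padic_Cauchy_add:
  assumes "padic_Cauchy p X" "padic_Cauchy p Y"
  shows "padic_Cauchy p (\<lambda>n. X n + Y n)"
  unfolding padic_Cauchy_def
proof (intro allI impI)
  fix e :: real assume "e > 0"
  then obtain M N where M: "\<And>m n. m \<ge> M \<Longrightarrow> n \<ge> M \<Longrightarrow> padic_norm p (X m - X n) < e"
    and N: "\<And>m n. m \<ge> N \<Longrightarrow> n \<ge> N \<Longrightarrow> padic_norm p (Y m - Y n) < e"
    using assms by (meson padic_Cauchy_def)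
  have "padic_norm p (X m + Y m - (X n + Y n)) < e" if "m \<ge> max M N" "n \<ge> max M N" for m n
    using padic_norm_add_max[of "X m - X n" "Y m - Y n"] M[of m n] N[of m n] that
    by (simp add: algebra_simps)
  then show "\<exists>N. \<forall>m\<ge>N. \<forall>n\<ge>N. padic_norm p (X m + Y m - (X n + Y n)) < e" by blast
qed

lemma padic_Cauchy_minus:
  assumes "padic_Cauchy p X" shows "padic_Cauchy p (\<lambda>n. - X n)"
proof -
  have "padic_norm p (- X m - - X n) = padic_norm p (X m - X n)" for m n
    using padic_norm_minus[of "X m - X n"] by simp
  then show ?thesis using assms by (simp add: padic_Cauchy_def)
qed

lemma comm_group_Cauchy: "comm_group Cauchy_group"
proof (rule comm_groupI)
  fix X assume "X \<in> carrier Cauchy_group"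
  then have "(\<lambda>n. - X n) \<in> carrier Cauchy_group" by (simp add: Cauchy_group_simps padic_Cauchy_minus)
  then show "\<exists>Y\<in>carrier Cauchy_group. Y \<otimes>\<^bsub>Cauchy_group\<^esub> X = \<one>\<^bsub>Cauchy_group\<^esub>"
    by (rule bexI[rotated]) (simp add: Cauchy_group_simps)
qed (auto intro: padic_Cauchy_add padic_Cauchy_const simp: Cauchy_group_simps algebra_simps)

interpretation C: comm_group Cauchy_group
  by (rule comm_group_Cauchy)

lemma Cauchy_group_inv:
  assumes "X \<in> carrier Cauchy_group" shows "inv\<^bsub>Cauchy_group\<^esub> X = (\<lambda>n. - X n)"
  by (rule C.inv_equality) (use assms padic_Cauchy_minus[of X] in \<open>auto simp: Cauchy_group_simps\<close>)

lemma Cauchy_group_pow: "X [^]\<^bsub>Cauchy_group\<^esub> (k :: nat) = (\<lambda>n. of_nat k * X n)"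
  by (induction k) (simp_all add: Cauchy_group_simps algebra_simps)

text \<open>The reverse triangle inequality makes the norms a real Cauchy sequence.\<close>

lemma padic_norm_convergent:
  assumes "padic_Cauchy p X" shows "convergent (\<lambda>n. padic_norm p (X n))"
proof (rule real_Cauchy_convergent, rule metric_CauchyI)
  fix e :: real assume "e > 0"
  then obtain N where "\<And>m n. m \<ge> N \<Longrightarrow> n \<ge> N \<Longrightarrow> padic_norm p (X m - X n) < e"
    using assms by (meson padic_Cauchy_def)
  then show "\<exists>N. \<forall>m\<ge>N. \<forall>n\<ge>N. dist (padic_norm p (X m)) (padic_norm p (X n)) < e"
    unfolding dist_real_def using padic_norm_abs_diff le_less_trans by meson
qed

lemma subgroup_null: "subgroup (padic_null p) Cauchy_group"
proof (rule C.subgroupI)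
  show "padic_null p \<subseteq> carrier Cauchy_group"
  proof
    fix X assume "X \<in> padic_null p"
    then have X: "(\<lambda>n. padic_norm p (X n)) \<longlonglongrightarrow> 0" by (simp add: padic_null_def)
    have "\<exists>N. \<forall>m\<ge>N. \<forall>n\<ge>N. padic_norm p (X m - X n) < e" if "e > 0" for e
    proof -
      obtain N where N: "\<And>n. n \<ge> N \<Longrightarrow> padic_norm p (X n) < e"
        using LIMSEQ_D[OF X \<open>e > 0\<close>] by auto
      have "padic_norm p (X m - X n) < e" if "m \<ge> N" "n \<ge> N" for m n
        using padic_norm_add_max[of "X m" "- X n"] N[of m] N[of n] that
        by (simp add: padic_norm_minus)
      then show ?thesis by blast
    qed
    then show "X \<in> carrier Cauchy_group" by (simp add: Cauchy_group_simps padic_Cauchy_def)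
  qed
  then show "inv\<^bsub>Cauchy_group\<^esub> X \<in> padic_null p" if "X \<in> padic_null p" for X
    using that by (auto simp: Cauchy_group_inv subset_iff padic_null_def padic_norm_minus)
  show "padic_null p \<noteq> {}" by (auto simp: padic_null_def intro!: exI[of _ "\<lambda>n. 0"])
  show "X \<otimes>\<^bsub>Cauchy_group\<^esub> Y \<in> padic_null p" if "X \<in> padic_null p" "Y \<in> padic_null p" for X Y
  proof -
    have "(\<lambda>n. padic_norm p (X n) + padic_norm p (Y n)) \<longlonglongrightarrow> 0"
      using that tendsto_add[of _ 0 sequentially _ 0] by (simp add: padic_null_def)
    then have "(\<lambda>n. padic_norm p (X n + Y n)) \<longlonglongrightarrow> 0"
      by (rule tendsto_0_le[where K = 1]) (simp add: padic_norm_add)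
    then show ?thesis by (simp add: padic_null_def Cauchy_group_simps)
  qed
qed

lemma normal_null: "padic_null p \<lhd> Cauchy_group"
  by (simp add: C.normal_iff_subgroup subgroup_null)

section \<open>The additive group of p-adic numbers and its integers\<close>

definition Qp_group :: "(nat \<Rightarrow> rat) set monoid" where
  "Qp_group = Cauchy_group Mod padic_null p"

text \<open>Additive cosets and their sums in the ring quotient unfold to the cosets and products of
  the group quotient.\<close>

lemma add_monoid_Qp: "add_monoid (Qp p) = Qp_group"
  by (simp add: Qp_def FactRing_def FactGroup_def A_RCOSETS_def set_add_def Qp_group_def Cauchy_group_def)

lemma comm_group_Qp_group: "comm_group Qp_group"
  unfolding Qp_group_def by (rule C.abelian_FactGroup[OF subgroup_null])

interpretation Q: comm_group Qp_group
  by (rule comm_group_Qp_group)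

abbreviation cls :: "(nat \<Rightarrow> rat) \<Rightarrow> (nat \<Rightarrow> rat) set" where
  "cls X \<equiv> padic_null p #>\<^bsub>Cauchy_group\<^esub> X"

lemma cls_hom: "cls \<in> hom Cauchy_group Qp_group"
  unfolding Qp_group_def by (rule normal.r_coset_hom_Mod[OF normal_null])

lemma carrier_Qp_group: "carrier Qp_group = cls ` carrier Cauchy_group"
  by (auto simp: Qp_group_def FactGroup_def RCOSETS_def)

text \<open>Members of a class differ by null sequences, so their norms share one limit; this
  justifies the description operator in \<open>Qp_norm\<close>.\<close>

lemma Qp_norm_cls:
  assumes X: "X \<in> carrier Cauchy_group" and L: "(\<lambda>n. padic_norm p (X n)) \<longlonglongrightarrow> L"
  shows "Qp_norm p (cls X) = L"
  unfolding Qp_norm_def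
proof (rule the_equality)
  show "\<forall>Y\<in>cls X. (\<lambda>n. padic_norm p (Y n)) \<longlonglongrightarrow> L"
  proof
    fix Y assume "Y \<in> cls X"
    then obtain Z where Z: "Z \<in> padic_null p" "Y = (\<lambda>n. Z n + X n)"
      by (auto simp: r_coset_def Cauchy_group_simps)
    have "(\<lambda>n. padic_norm p (Y n) - padic_norm p (X n)) \<longlonglongrightarrow> 0"
    proof (rule tendsto_0_le[where K = 1])
      show "(\<lambda>n. padic_norm p (Z n)) \<longlonglongrightarrow> 0" using Z by (simp add: padic_null_def)
      show "\<forall>\<^sub>F n in sequentially. norm (padic_norm p (Y n) - padic_norm p (X n)) \<le> norm (padic_norm p (Z n)) * 1"
      proof (rule always_eventually, rule allI)
        fix n
        show "norm (padic_norm p (Y n) - padic_norm p (X n)) \<le> norm (padic_norm p (Z n)) * 1"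
          using padic_norm_abs_diff[of "Y n" "X n"] Z by simp
      qed
    qed
    from tendsto_add[OF this L] show "(\<lambda>n. padic_norm p (Y n)) \<longlonglongrightarrow> L" by simp
  qed
  fix r assume "\<forall>Y\<in>cls X. (\<lambda>n. padic_norm p (Y n)) \<longlonglongrightarrow> r"
  then have "(\<lambda>n. padic_norm p (X n)) \<longlonglongrightarrow> r" using C.rcos_self[OF X subgroup_null] by blast
  then show "r = L" using L LIMSEQ_unique by blast
qed

text \<open>This is the preimage of \<open>Zp p\<close> among Cauchy sequences, phrased by terms
  instead of limits.\<close>

definition int_seqs :: "(nat \<Rightarrow> rat) set" where
  "int_seqs = {X \<in> carrier Cauchy_group. \<forall>\<^sub>F n in sequentially. padic_norm p (X n) \<le> 1}"

text \<open>If the norms tend to a limit at most 1, they are eventually below \<open>p\<close>,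
  hence at most 1 by discreteness.\<close>

lemma cls_mem_Zp:
  assumes X: "X \<in> carrier Cauchy_group"
  shows "cls X \<in> Zp p \<longleftrightarrow> X \<in> int_seqs"
proof -
  obtain L where L: "(\<lambda>n. padic_norm p (X n)) \<longlonglongrightarrow> L"
    using padic_norm_convergent[of X] X by (auto simp: Cauchy_group_simps convergent_def)
  have "carrier (Qp p) = carrier Qp_group"
    using arg_cong[OF add_monoid_Qp, of carrier] by simp
  then have "cls X \<in> Zp p \<longleftrightarrow> L \<le> 1"
    using X by (simp add: Zp_def Qp_norm_cls[OF X L] carrier_Qp_group)
  also have "\<dots> \<longleftrightarrow> X \<in> int_seqs"
  proof
    assume "L \<le> 1"
    then have "L < real p" using p_gt_1 by simp
    then have "\<forall>\<^sub>F n in sequentially. padic_norm p (X n) < real p"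
      using L by (simp add: order_tendstoD)
    then show "X \<in> int_seqs"
      using X padic_norm_discrete[of _ 1] by (auto simp: int_seqs_def elim: eventually_mono)
  next
    assume "X \<in> int_seqs"
    then show "L \<le> 1" using tendsto_upperbound[OF L] by (simp add: int_seqs_def)
  qed
  finally show ?thesis .
qed

lemma subgroup_int_seqs: "subgroup int_seqs Cauchy_group"
proof (rule C.subgroupI)
  show "int_seqs \<noteq> {}"
    by (auto simp: int_seqs_def Cauchy_group_simps intro!: exI[of _ "\<lambda>n. 0"] padic_Cauchy_const)
  show "inv\<^bsub>Cauchy_group\<^esub> X \<in> int_seqs" if "X \<in> int_seqs" for X
    using that C.inv_closed[of X] unfolding int_seqs_def by (simp add: Cauchy_group_inv padic_norm_minus)
  show "X \<otimes>\<^bsub>Cauchy_group\<^esub> Y \<in> int_seqs" if "X \<in> int_seqs" "Y \<in> int_seqs" for X Y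
  proof -
    have "\<forall>\<^sub>F n in sequentially. padic_norm p (X n) \<le> 1 \<and> padic_norm p (Y n) \<le> 1"
      using that by (simp add: int_seqs_def eventually_conj)
    then have "\<forall>\<^sub>F n in sequentially. padic_norm p (X n + Y n) \<le> 1"
      by (rule eventually_mono) (use padic_norm_add_max in \<open>fastforce intro: order_trans\<close>)
    then show ?thesis using that C.m_closed[of X Y] by (simp add: int_seqs_def Cauchy_group_simps)
  qed
qed (auto simp: int_seqs_def)

lemma Zp_eq: "Zp p = cls ` int_seqs"
proof -
  have "Zp p \<subseteq> carrier Qp_group"
    using arg_cong[OF add_monoid_Qp, of carrier] by (auto simp: Zp_def)
  then show ?thesis
    using cls_mem_Zp unfolding carrier_Qp_group by (auto simp: int_seqs_def)
qed

lemma subgroup_Zp: "subgroup (Zp p) Qp_group"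
proof -
  interpret group_hom Cauchy_group Qp_group cls
    by (simp add: group_hom_def group_hom_axioms_def cls_hom)
  show ?thesis unfolding Zp_eq by (rule subgroup_img_is_subgroup[OF subgroup_int_seqs])
qed

section \<open>The quotient by the p-adic integers and its torsion\<close>

lemma Qp_mod_Zp_eq: "Qp_mod_Zp p = Qp_group Mod Zp p"
  unfolding Qp_mod_Zp_def add_monoid_Qp ..

lemma comm_group_Qp_mod_Zp: "comm_group (Qp_mod_Zp p)"
  unfolding Qp_mod_Zp_eq by (rule Q.abelian_FactGroup[OF subgroup_Zp])

interpretation T: comm_group "Qp_mod_Zp p"
  by (rule comm_group_Qp_mod_Zp)

text \<open>The composite of both quotient projections, with kernel \<open>int_seqs\<close>, reduces
  questions about classes to rational sequences.\<close>

definition \<pi> :: "(nat \<Rightarrow> rat) \<Rightarrow> (nat \<Rightarrow> rat) set set" where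
  "\<pi> X = Zp p #>\<^bsub>Qp_group\<^esub> cls X"

lemma pi_hom: "\<pi> \<in> hom Cauchy_group (Qp_mod_Zp p)"
proof -
  have "Zp p \<lhd> Qp_group" by (simp add: Q.normal_iff_subgroup subgroup_Zp)
  from hom_compose[OF cls_hom normal.r_coset_hom_Mod[OF this]]
  show ?thesis by (simp add: \<pi>_def[abs_def] comp_def Qp_mod_Zp_eq)
qed

interpretation pi: group_hom Cauchy_group "Qp_mod_Zp p" \<pi>
  by (simp add: group_hom_def group_hom_axioms_def pi_hom)

lemma pi_surj: "carrier (Qp_mod_Zp p) = \<pi> ` carrier Cauchy_group"
proof -
  have "carrier (Qp_mod_Zp p) = (\<lambda>x. Zp p #>\<^bsub>Qp_group\<^esub> x) ` carrier Qp_group"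
    unfolding Qp_mod_Zp_eq FactGroup_def RCOSETS_def by auto
  then show ?thesis by (simp add: carrier_Qp_group image_image \<pi>_def)
qed

lemma pi_eq_one:
  assumes X: "X \<in> carrier Cauchy_group"
  shows "\<pi> X = \<one>\<^bsub>Qp_mod_Zp p\<^esub> \<longleftrightarrow> X \<in> int_seqs"
proof -
  have "cls X \<in> carrier Qp_group" using X by (simp add: carrier_Qp_group)
  then have "Zp p #>\<^bsub>Qp_group\<^esub> cls X = Zp p \<longleftrightarrow> cls X \<in> Zp p"
    using Q.coset_join1[OF _ _ subgroup_Zp] Q.coset_join2[OF _ subgroup_Zp]
      subgroup.subset[OF subgroup_Zp] by blast
  then show ?thesis using cls_mem_Zp[OF X] by (simp add: \<pi>_def Qp_mod_Zp_eq FactGroup_def)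
qed

lemma pi_eqI:
  assumes X: "X \<in> carrier Cauchy_group" and Y: "Y \<in> carrier Cauchy_group"
    and "\<forall>\<^sub>F n in sequentially. padic_norm p (X n - Y n) \<le> 1"
  shows "\<pi> X = \<pi> Y"
proof -
  have D: "X \<otimes>\<^bsub>Cauchy_group\<^esub> inv\<^bsub>Cauchy_group\<^esub> Y \<in> int_seqs"
    using assms C.m_closed[OF X C.inv_closed[OF Y]]
    by (simp add: int_seqs_def Cauchy_group_inv Cauchy_group_simps)
  then have "\<pi> (X \<otimes>\<^bsub>Cauchy_group\<^esub> inv\<^bsub>Cauchy_group\<^esub> Y) = \<one>\<^bsub>Qp_mod_Zp p\<^esub>"
    using X Y pi_eq_one[of "X \<otimes>\<^bsub>Cauchy_group\<^esub> inv\<^bsub>Cauchy_group\<^esub> Y"] by (simp del: monoid.simps add: int_seqs_def)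
  then have "\<pi> X \<otimes>\<^bsub>Qp_mod_Zp p\<^esub> inv\<^bsub>Qp_mod_Zp p\<^esub> \<pi> Y = \<one>\<^bsub>Qp_mod_Zp p\<^esub>"
    using pi.hom_mult[OF X C.inv_closed[OF Y]] pi.hom_inv[OF Y] by simp
  then show ?thesis
    using T.inv_solve_right'[of "\<one>\<^bsub>Qp_mod_Zp p\<^esub>" "\<pi> X" "\<pi> Y"] pi.hom_closed[OF X] pi.hom_closed[OF Y]
    by (simp add: T.inv_solve_right')
qed

text \<open>The norms of a Cauchy sequence are eventually below some \<open>p ^ k\<close>, and
  multiplication by \<open>p ^ k\<close> brings them down to at most 1.\<close>

lemma Qp_mod_Zp_primary:
  assumes "x \<in> carrier (Qp_mod_Zp p)"
  shows "\<exists>k::nat. x [^]\<^bsub>Qp_mod_Zp p\<^esub> (p ^ k) = \<one>\<^bsub>Qp_mod_Zp p\<^esub>"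
proof -
  obtain X where X: "X \<in> carrier Cauchy_group" "x = \<pi> X" using assms pi_surj by blast
  obtain L where L: "(\<lambda>n. padic_norm p (X n)) \<longlonglongrightarrow> L"
    using padic_norm_convergent[of X] X by (auto simp: Cauchy_group_simps convergent_def)
  obtain k where k: "L < real p ^ k" using real_arch_pow[OF p_gt_1] by blast
  have "\<forall>\<^sub>F n in sequentially. padic_norm p (X n) < real p ^ k"
    using L k by (simp add: order_tendstoD)
  then have "\<forall>\<^sub>F n in sequentially. padic_norm p (of_nat (p ^ k) * X n) \<le> 1"
    using p_gt_1
    by (auto simp: padic_norm_mult padic_norm_of_nat_power field_simps elim!: eventually_mono)
  then have "X [^]\<^bsub>Cauchy_group\<^esub> (p ^ k) \<in> int_seqs"
    using C.nat_pow_closed[OF X(1), of "p ^ k"] unfolding int_seqs_def by (simp add: Cauchy_group_pow)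
  then have "\<pi> (X [^]\<^bsub>Cauchy_group\<^esub> (p ^ k)) = \<one>\<^bsub>Qp_mod_Zp p\<^esub>"
    using pi_eq_one[of "X [^]\<^bsub>Cauchy_group\<^esub> (p ^ k)"] by (simp add: int_seqs_def)
  then show ?thesis
    using X pi.hom_nat_pow[OF X(1)] by auto
qed

text \<open>A fraction of norm at most 1 has reduced denominator \<open>d\<close> prime to
  \<open>p\<close>. With \<open>u\<close> an inverse of \<open>d\<close> modulo \<open>p\<close>,
  the residue is \<open>c * u mod p\<close>.\<close>

lemma ex_residue:
  assumes "padic_norm p x \<le> 1"
  shows "\<exists>j<p. padic_norm p (x - of_nat j) \<le> 1 / real p"
proof -
  obtain c d where q: "quotient_of x = (c, d)" by force
  have d: "d > 0" "coprime c d" and x: "x = of_int c / of_int d"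
    using quotient_of_denom_pos[OF q] quotient_of_coprime[OF q] quotient_of_div[OF q] by auto
  have nd: "\<not> int p dvd d"
  proof
    assume pd: "int p dvd d"
    have "\<not> int p dvd c"
      using pd d(2) prime_elem_int by (meson coprime_common_divisor prime_elem_not_unit)
    then have c: "c \<noteq> 0" "multiplicity (int p) c = 0" by (auto intro: not_dvd_imp_multiplicity_0)
    have "multiplicity (int p) d > 0"
      using pd d(1) prime_elem_int by (simp add: prime_multiplicity_gt_zero_iff)
    then have "1 < padic_norm p x"
      using c d(1) p_gt_1 by (simp add: x padic_norm_frac one_less_power)
    then show False using assms by simp
  qed
  then have "coprime d (int p)"
    using prime_imp_coprime[of "int p" d] prime by (simp add: coprime_commute)
  then obtain u v where uv: "u * d + v * int p = 1"
    using bezout_int[of d "int p"] by auto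
  define j where "j = nat (c * u mod int p)"
  have p0: "int p > 0" using p_gt_1 by simp
  have j: "int j = c * u mod int p" using p0 by (simp add: j_def)
  then have "j < p" using p0 by (metis of_nat_less_iff pos_mod_bound)
  \<comment> \<open>One expression is evaluated twice: by the Bezout relation it is
    \<open>c - d * int j\<close>, and after expansion the terms \<open>c * u * d\<close> cancel,
    leaving a multiple of \<open>p\<close>.\<close>
  have "c * (u * d + v * int p) - d * (c * u - int p * (c * u div int p)) = c - d * int j"
    unfolding uv by (simp add: j minus_mult_div_eq_mod)
  moreover have "c * (u * d + v * int p) - d * (c * u - int p * (c * u div int p))
      = int p * (c * v + d * (c * u div int p))"
    by (simp add: algebra_simps)
  ultimately have dvd: "int p dvd c - d * int j" by (metis dvd_triv_left)
  have eq: "x - of_nat j = of_int (c - d * int j) / of_int d"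
    using d(1) by (simp add: x field_simps)
  have "padic_norm p (x - of_nat j) \<le> 1 / real p"
  proof (cases "c - d * int j = 0")
    case True
    then show ?thesis using eq by simp
  next
    case False
    have "multiplicity (int p) (c - d * int j) > 0"
      using dvd False prime_elem_int by (simp add: prime_multiplicity_gt_zero_iff)
    then have "real p powi (- int (multiplicity (int p) (c - d * int j))) \<le> real p powi (- 1)"
      using p_gt_1 by (intro power_int_increasing) auto
    moreover have "padic_norm p (x - of_nat j) = real p powi (- int (multiplicity (int p) (c - d * int j)))"
      unfolding eq using False d(1) not_dvd_imp_multiplicity_0[OF nd] by (subst padic_norm_frac) auto
    ultimately show ?thesis by (simp add: power_int_minus field_simps)
  qed
  then show ?thesis using \<open>j < p\<close> by blast
qed

text \<open>If \<open>p\<close> times a sequence is integral with residue \<open>j\<close>, then the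
  sequence differs from \<open>j / p\<close> by an integral one. Only an inclusion is stated, which
  suffices for an upper bound on the torsion.\<close>

lemma Qp_mod_Zp_torsion:
  "{x \<in> carrier (Qp_mod_Zp p). x [^]\<^bsub>Qp_mod_Zp p\<^esub> p = \<one>\<^bsub>Qp_mod_Zp p\<^esub>}
    \<subseteq> (\<lambda>j. \<pi> (\<lambda>n. of_nat j / of_nat p)) ` {..<p}"
proof clarify
  fix x assume "x \<in> carrier (Qp_mod_Zp p)" and xp: "x [^]\<^bsub>Qp_mod_Zp p\<^esub> p = \<one>\<^bsub>Qp_mod_Zp p\<^esub>"
  then obtain X where X: "X \<in> carrier Cauchy_group" "x = \<pi> X" using pi_surj by blast
  have "\<pi> (X [^]\<^bsub>Cauchy_group\<^esub> p) = \<one>\<^bsub>Qp_mod_Zp p\<^esub>"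
    using X xp pi.hom_nat_pow[OF X(1)] by simp
  then have int: "X [^]\<^bsub>Cauchy_group\<^esub> p \<in> int_seqs" using pi_eq_one[of "X [^]\<^bsub>Cauchy_group\<^esub> p"] X by simp
  then obtain M where M: "\<And>n. n \<ge> M \<Longrightarrow> padic_norm p (of_nat p * X n) \<le> 1"
    by (auto simp: int_seqs_def Cauchy_group_pow eventually_sequentially)
  obtain N where N: "\<And>m n. m \<ge> N \<Longrightarrow> n \<ge> N \<Longrightarrow> padic_norm p (X m - X n) < 1"
    using X(1) unfolding Cauchy_group_simps padic_Cauchy_def by (metis mem_Collect_eq zero_less_one)
  \<comment> \<open>At index \<open>K\<close> the term \<open>p * X K\<close> is integral, and all
    later terms of \<open>X\<close> lie within distance less than 1 of \<open>X K\<close>.\<close>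
  define K where "K = max M N"
  obtain j where j: "j < p" "padic_norm p (of_nat p * X K - of_nat j) \<le> 1 / real p"
    using ex_residue[OF M[of K]] by (auto simp: K_def)
  have p0: "of_nat p \<noteq> (0::rat)" using p_gt_1 by simp
  then have "of_nat p * X K - of_nat j = of_nat p * (X K - of_nat j / of_nat p)"
    by (simp add: right_diff_distrib)
  then have "1 / real p * padic_norm p (X K - of_nat j / of_nat p) \<le> 1 / real p"
    using j(2) by (simp only: padic_norm_mult padic_norm_self)
  then have K: "padic_norm p (X K - of_nat j / of_nat p) \<le> 1"
    using p_gt_1 by (simp add: field_simps)
  have "padic_norm p (X n - of_nat j / of_nat p) \<le> 1" if "n \<ge> K" for n
    using padic_norm_add_max[of "X n - X K" "X K - of_nat j / of_nat p"] K N[of n K] that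
    by (simp add: K_def)
  then have "\<forall>\<^sub>F n in sequentially. padic_norm p (X n - of_nat j / of_nat p) \<le> 1"
    unfolding eventually_sequentially by blast
  then have "x = \<pi> (\<lambda>n. of_nat j / of_nat p)"
    unfolding X(2) by (intro pi_eqI X(1)) (simp_all add: Cauchy_group_simps padic_Cauchy_const)
  then show "x \<in> (\<lambda>j. \<pi> (\<lambda>n. of_nat j / of_nat p)) ` {..<p}" using j(1) by blast
qed

section \<open>The torus\<close>

lemma comm_group_TT: "comm_group (TT p)"
proof (rule group.group_comm_groupI)
  show "Group.group (TT p)" unfolding TT_def by (rule DirProd_group) (rule T.is_group)+
qed (auto simp: TT_def T.m_comm)

lemma TT_pow: "(x, y) [^]\<^bsub>TT p\<^esub> (n :: nat) = (x [^]\<^bsub>Qp_mod_Zp p\<^esub> n, y [^]\<^bsub>Qp_mod_Zp p\<^esub> n)"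
  by (induction n) (simp_all add: TT_def)

lemma mult_p_eq: "mult_p p = (\<lambda>x\<in>carrier (TT p). x [^]\<^bsub>TT p\<^esub> p)"
  by (auto simp: mult_p_def TT_pow fun_eq_iff restrict_def)

text \<open>The product of the powers of \<open>p\<close> killing the two coordinates kills
  both.\<close>

lemma TT_primary:
  assumes "x \<in> carrier (TT p)"
  shows "\<exists>k::nat. x [^]\<^bsub>TT p\<^esub> (p ^ k) = \<one>\<^bsub>TT p\<^esub>"
proof -
  obtain a b where x: "x = (a, b)" "a \<in> carrier (Qp_mod_Zp p)" "b \<in> carrier (Qp_mod_Zp p)"
    using assms by (auto simp: TT_def)
  obtain k l :: nat where "a [^]\<^bsub>Qp_mod_Zp p\<^esub> (p ^ k) = \<one>\<^bsub>Qp_mod_Zp p\<^esub>"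
    "b [^]\<^bsub>Qp_mod_Zp p\<^esub> (p ^ l) = \<one>\<^bsub>Qp_mod_Zp p\<^esub>"
    using Qp_mod_Zp_primary x by meson
  then have "a [^]\<^bsub>Qp_mod_Zp p\<^esub> (p ^ k * p ^ l) = \<one>\<^bsub>Qp_mod_Zp p\<^esub>"
    "b [^]\<^bsub>Qp_mod_Zp p\<^esub> (p ^ l * p ^ k) = \<one>\<^bsub>Qp_mod_Zp p\<^esub>"
    using x by (simp_all flip: T.nat_pow_pow)
  then have "x [^]\<^bsub>TT p\<^esub> (p ^ (k + l)) = \<one>\<^bsub>TT p\<^esub>"
    by (simp add: x TT_pow power_add mult.commute) (simp add: TT_def)
  then show ?thesis ..
qed

text \<open>The torsion is the square of that of one factor, which has at most \<open>p\<close>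
  elements.\<close>

lemma TT_torsion:
  "finite {x \<in> carrier (TT p). x [^]\<^bsub>TT p\<^esub> p = \<one>\<^bsub>TT p\<^esub>}" (is "finite ?T")
  "card {x \<in> carrier (TT p). x [^]\<^bsub>TT p\<^esub> p = \<one>\<^bsub>TT p\<^esub>} \<le> p\<^sup>2"
proof -
  let ?A = "{x \<in> carrier (Qp_mod_Zp p). x [^]\<^bsub>Qp_mod_Zp p\<^esub> p = \<one>\<^bsub>Qp_mod_Zp p\<^esub>}"
  have fin: "finite ?A"
    using Qp_mod_Zp_torsion by (rule finite_subset) simp
  have "card ?A \<le> card {..<p}"
    by (rule surj_card_le[OF _ Qp_mod_Zp_torsion]) simp
  then have card: "card ?A \<le> p" unfolding card_lessThan .
  have T: "?T = ?A \<times> ?A"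
    by (auto simp: TT_pow) (auto simp: TT_def)
  show "finite ?T" unfolding T using fin by blast
  show "card ?T \<le> p\<^sup>2"
    unfolding T card_cartesian_product power2_eq_square using card by (intro mult_le_mono)
qed

end

text \<open>The torus is an instance of \<open>prime_sqrt_system\<close>. The final clause says that
  the power section extends the given choice.\<close>

theorem proposition6p13:
  fixes p :: nat and \<psi> :: "torus_point set \<Rightarrow> torus_point \<Rightarrow> torus_point"
  assumes "Factorial_Ring.prime p"
    and "\<And>H. subgroup H (TT p) \<Longrightarrow> card H = p \<Longrightarrow>
           \<psi> H \<in> carrier (End (TT p)) \<and>
           \<psi> H \<otimes>\<^bsub>End (TT p)\<^esub> \<psi> H = mult_p p \<and>
           \<psi> H ` p_torsion p = H"
  shows "\<exists>\<phi>. power_section (TT p) \<phi> \<and>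
           (\<forall>H. subgroup H (TT p) \<longrightarrow> card H = p \<longrightarrow> \<phi> H = \<psi> H)"
proof -
  have "prime_sqrt_system (TT p) p \<psi>"
  proof (intro prime_sqrt_system.intro prime_sqrt_system_axioms.intro)
    show "comm_group (TT p)" "Factorial_Ring.prime p"
      using assms(1) by (simp_all add: comm_group_TT)
    show "finite {x \<in> carrier (TT p). x [^]\<^bsub>TT p\<^esub> p = \<one>\<^bsub>TT p\<^esub>}"
      "card {x \<in> carrier (TT p). x [^]\<^bsub>TT p\<^esub> p = \<one>\<^bsub>TT p\<^esub>} \<le> p\<^sup>2"
      using TT_torsion[OF assms(1)] .
    show "\<exists>k::nat. x [^]\<^bsub>TT p\<^esub> (p ^ k) = \<one>\<^bsub>TT p\<^esub>" if "x \<in> carrier (TT p)" for x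
      using TT_primary[OF assms(1) that] .
    fix H assume H: "subgroup H (TT p)" "card H = p"
    show "\<psi> H \<in> carrier (End (TT p))" using assms(2)[OF H] by blast
    show "\<psi> H ` {x \<in> carrier (TT p). x [^]\<^bsub>TT p\<^esub> p = \<one>\<^bsub>TT p\<^esub>} = H"
      using assms(2)[OF H] by (simp add: p_torsion_def)
    have sq: "compose (carrier (TT p)) (\<psi> H) (\<psi> H) = mult_p p"
      using assms(2)[OF H] by (simp add: End_def)
    \<comment> \<open>The matrix identity is an equality of extensional functions; evaluating it at
      a point gives the pointwise form.\<close>
    show "\<psi> H (\<psi> H x) = x [^]\<^bsub>TT p\<^esub> p" if "x \<in> carrier (TT p)" for x
      using fun_cong[OF sq, of x] that by (simp add: mult_p_eq[OF assms(1)] compose_def)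
  qed
  then show ?thesis by (rule prime_sqrt_system.ex_power_section)
qed

end
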